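(* Let $n$ be a positive integer. For every integer $t$ with $2\le t\le n-3$: \begin{itemize} \item if $t \equiv 2 \pmod 4$ then $\Delta_n^t=O_n$; \item if $t \equiv 3 \pmod 4$ then $\Delta_n^t=OP_n$; \item if $t \equiv 0 \pmod 4$ then $\Delta_n^t=M_n$; \item if $t \equiv 1 \pmod 4$ then $\Delta_n^t=OR_n$. \end{itemize}
   Context: $[n]=\{0,1,\dots,n-1\}$ with its usual order; mappings are full mappings $[n]\to[n]$, and the rank of a mapping is the size of its image. An inversion of a one-to-one partial mapping $\alpha$ on $[n]$ is a pair $a,b$ in its domain with $a<b$ and $\alpha(a)>\alpha(b)$; $\alpha$ is even if its number of inversions is even. A restriction of width $t$ is a restriction to a $t$-element subset of $[n]$. For $1\le t\le n$, $\Delta_n^t$ is the monoid generated (under composition) by all mappings on $[n]$ of rank at least $n-1$ all of whose injective restrictions of width $t$ are even. A mapping $\alpha$ is order-preserving (resp. order-reversing) if $x<y$ implies $\alpha(x)\le\alpha(y)$ (resp. $\alpha(x)\ge\alpha(y)$); it is monotone if it is order-preserving or order-reversing. A sequence $(a_1,\dots,a_s)$ of elements of $[n]$ is cyclic (resp. anti-cyclic) if there is at most one index $i\in\{1,\dots,s\}$ with $a_i>a_{i+1}$ (resp. $a_i<a_{i+1}$), where $a_{s+1}=a_1$; it is oriented if it is cyclic or anti-cyclic. A mapping $\alpha$ is orientation-preserving (resp. oriented) if the sequence $(\alpha(0),\alpha(1),\dots,\alpha(n-1))$ is cyclic (resp. oriented). $O_n$, $M_n$, $OP_n$, $OR_n$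 are the monoids of all order-preserving, all monotone, all orientation-preserving, and all oriented mappings on $[n]$, respectively. *)

theory Defs
  imports Main "HOL-Library.FuncSet"
begin

text \<open>
  A mapping on \<open>[n]\<close> is represented by the unique function that is \<open>undefined\<close> outside
  \<open>{..<n}\<close>, so that equality of sets of mappings is equality of sets of such functions;
  composition is accordingly \<^const>\<open>compose\<close>.
\<close>

definition mappings :: "nat \<Rightarrow> (nat \<Rightarrow> nat) set" where
  "mappings n = {..<n} \<rightarrow>\<^sub>E {..<n}"

definition map_rank :: "nat \<Rightarrow> (nat \<Rightarrow> nat) \<Rightarrow> nat" where
  "map_rank n \<alpha> = card (\<alpha> ` {..<n})"

text \<open>The domain \<open>D\<close> is explicit: below, the partial mapping is the restriction of \<open>\<alpha>\<close> to \<open>D\<close>.\<close>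

definition inversions :: "nat set \<Rightarrow> (nat \<Rightarrow> nat) \<Rightarrow> (nat \<times> nat) set" where
  "inversions D \<alpha> = {(a, b). a \<in> D \<and> b \<in> D \<and> a < b \<and> \<alpha> a > \<alpha> b}"

definition even_on :: "nat set \<Rightarrow> (nat \<Rightarrow> nat) \<Rightarrow> bool" where
  "even_on D \<alpha> \<longleftrightarrow> even (card (inversions D \<alpha>))"

definition Delta_gens :: "nat \<Rightarrow> nat \<Rightarrow> (nat \<Rightarrow> nat) set" where
  "Delta_gens n t = {\<alpha> \<in> mappings n. n - 1 \<le> map_rank n \<alpha> \<and>
     (\<forall>D. D \<subseteq> {..<n} \<and> card D = t \<and> inj_on \<alpha> D \<longrightarrow> even_on D \<alpha>)}"

inductive_set generated_monoid :: "nat \<Rightarrow> (nat \<Rightarrow> nat) set \<Rightarrow> (nat \<Rightarrow> nat) set"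
  for n :: nat and G :: "(nat \<Rightarrow> nat) set" where
  one: "(\<lambda>x\<in>{..<n}. x) \<in> generated_monoid n G"
| incl: "\<alpha> \<in> G \<Longrightarrow> \<alpha> \<in> generated_monoid n G"
| comp: "\<alpha> \<in> generated_monoid n G \<Longrightarrow> \<beta> \<in> generated_monoid n G \<Longrightarrow>
    compose {..<n} \<alpha> \<beta> \<in> generated_monoid n G"

definition Delta :: "nat \<Rightarrow> nat \<Rightarrow> (nat \<Rightarrow> nat) set" where
  "Delta n t = generated_monoid n (Delta_gens n t)"

definition order_preserving :: "nat \<Rightarrow> (nat \<Rightarrow> nat) \<Rightarrow> bool" where
  "order_preserving n \<alpha> \<longleftrightarrow> monotone_on {..<n} (<) (\<le>) \<alpha>"

definition order_reversing :: "nat \<Rightarrow> (nat \<Rightarrow> nat) \<Rightarrow> bool" where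
  "order_reversing n \<alpha> \<longleftrightarrow> monotone_on {..<n} (<) (\<ge>) \<alpha>"

definition cyclic_seq :: "nat list \<Rightarrow> bool" where
  "cyclic_seq as \<longleftrightarrow>
     card {i. i < length as \<and> as ! i > as ! (Suc i mod length as)} \<le> 1"

definition anti_cyclic_seq :: "nat list \<Rightarrow> bool" where
  "anti_cyclic_seq as \<longleftrightarrow>
     card {i. i < length as \<and> as ! i < as ! (Suc i mod length as)} \<le> 1"

definition oriented_seq :: "nat list \<Rightarrow> bool" where
  "oriented_seq as \<longleftrightarrow> cyclic_seq as \<or> anti_cyclic_seq as"

definition O_maps :: "nat \<Rightarrow> (nat \<Rightarrow> nat) set" where
  "O_maps n = {\<alpha> \<in> mappings n. order_preserving n \<alpha>}"

definition M_maps :: "nat \<Rightarrow> (nat \<Rightarrow> nat) set" where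
  "M_maps n = {\<alpha> \<in> mappings n. order_preserving n \<alpha> \<or> order_reversing n \<alpha>}"

definition OP_maps :: "nat \<Rightarrow> (nat \<Rightarrow> nat) set" where
  "OP_maps n = {\<alpha> \<in> mappings n. cyclic_seq (map \<alpha> [0..<n])}"

definition OR_maps :: "nat \<Rightarrow> (nat \<Rightarrow> nat) set" where
  "OR_maps n = {\<alpha> \<in> mappings n. oriented_seq (map \<alpha> [0..<n])}"

end

theory Submission
  imports Defs
begin

text \<open>
  Both inclusions rest on one observation: the parity of the number of inversions inside a
  three-element set tells the orientation. Three distinct values in positions
  \<open>x < y < z\<close> have an even number of inversions exactly if they are in cyclic order.

  \<^bold>\<open>From generators to the named monoids.\<close> Let \<open>\<alpha>\<close> have rank at least \<open>n - 1\<close> and let all its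
  injective restrictions of width \<open>t\<close> be even. Comparing \<open>E \<union> {a, c}\<close>, \<open>E \<union> {b, c}\<close>,
  \<open>E \<union> {a, d}\<close> and \<open>E \<union> {b, d}\<close> for a set \<open>E\<close> of size \<open>t - 2\<close> shows that the triples
  \<open>{a, b, c}\<close> and \<open>{a, b, d}\<close> have the same parity (\<open>Delta_gens_exchange\<close>). An injective
  set that contains \<open>E\<close> and the four points exists because \<open>t + 2 \<le> n - 1\<close>. As at most one pair of
  points collides, exchanging one point at a time leads from each injective triple to each
  other one, so that all of them have one parity \<open>c\<close> (\<open>Delta_gens_triples_constant\<close>).
  If \<open>t\<close> is even, every pair of points with distinct values must itself have parity \<open>c\<close>, so
  \<open>\<alpha>\<close> is monotone. If \<open>t\<close> is odd, then \<open>\<alpha>\<close> is orientation-preserving for even triples and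
  anti-cyclic for odd ones: two cyclic descents would be seen by the triples among at most
  four points. Finally, a decreasing injective restriction of width \<open>t\<close> has \<open>t choose 2\<close>
  inversions, and a restriction of odd width \<open>2 * k + 1\<close> all of whose triples are odd has
  an inversion number of the parity of \<open>k\<close>. This is what excludes the reversing mappings
  if \<open>t mod 4\<close> is \<open>2\<close> or \<open>3\<close>.

  \<^bold>\<open>From the named monoids to generators.\<close> Order-preserving mappings have no inversions and
  are products of elementary collapses, which move one point by one place
  (\<open>O_maps_subset_Delta\<close>). An orientation-preserving mapping is an order-preserving one
  preceded by rotations, and the rotation is even on all sets of odd size. The reversal, which
  is even on all sets of size \<open>t\<close> if \<open>t mod 4\<close> is \<open>0\<close> or \<open>1\<close>, turns \<open>O\<^sub>n\<close> into \<open>M\<^sub>n\<close> and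
  \<open>OP\<^sub>n\<close> into \<open>OR\<^sub>n\<close>. That these sets are closed under composition follows from the same
  factorizations.
\<close>

section \<open>Parity of inversions in triples and in larger sets\<close>

definition discordant :: "(nat \<Rightarrow> nat) \<Rightarrow> nat \<Rightarrow> nat \<Rightarrow> bool" where
  "discordant \<alpha> x y \<longleftrightarrow> x < y \<and> \<alpha> y < \<alpha> x \<or> y < x \<and> \<alpha> x < \<alpha> y"

definition odd_triple :: "(nat \<Rightarrow> nat) \<Rightarrow> nat \<Rightarrow> nat \<Rightarrow> nat \<Rightarrow> bool" where
  "odd_triple \<alpha> x y z \<longleftrightarrow> (discordant \<alpha> x y \<noteq> (discordant \<alpha> y z \<noteq> discordant \<alpha> x z))"

lemma discordant_commute: "discordant \<alpha> x y = discordant \<alpha> y x"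
  by (auto simp: discordant_def)

lemma odd_triple_permute:
  "odd_triple \<alpha> x y z = odd_triple \<alpha> y x z"
  "odd_triple \<alpha> x y z = odd_triple \<alpha> x z y"
  using discordant_commute by (auto simp: odd_triple_def)

text \<open>
  Adding a point \<open>a\<close> to \<open>D\<close> adds the inversions that \<open>a\<close> takes part in. In the graph of
  inversions this is the degree of \<open>a\<close>, and all counting below is in terms of such degrees.
\<close>

lemma card_inversions_insert:
  assumes "finite D" "a \<notin> D"
  shows "card (inversions (insert a D) \<alpha>) = card (inversions D \<alpha>) + card {e \<in> D. discordant \<alpha> a e}"
proof -
  let ?f = "\<lambda>e. if a < e then (a, e) else (e, a)"
  let ?N = "{e \<in> D. discordant \<alpha> a e}"
  \<comment> \<open>A new inversion is the ordered pair formed by \<open>a\<close> and a point discordant with it.\<close>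
  have split: "inversions (insert a D) \<alpha> = inversions D \<alpha> \<union> ?f ` ?N"
  proof (rule set_eqI)
    fix p
    show "p \<in> inversions (insert a D) \<alpha> \<longleftrightarrow> p \<in> inversions D \<alpha> \<union> ?f ` ?N"
      by (cases p) (auto simp: inversions_def discordant_def image_iff)
  qed
  have card_N: "card (?f ` ?N) = card ?N"
    by (rule card_image) (auto simp: inj_on_def split: if_splits)
  have "finite (inversions D \<alpha>)"
    by (rule finite_subset[of _ "D \<times> D"]) (use assms in \<open>auto simp: inversions_def\<close>)
  moreover have "inversions D \<alpha> \<inter> ?f ` ?N = {}"
    using assms by (auto simp: inversions_def split: if_splits)
  moreover have "finite (?f ` ?N)" using assms(1) by simp
  ultimately have "card (inversions D \<alpha> \<union> ?f ` ?N) = card (inversions D \<alpha>) + card (?f ` ?N)"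
    by (intro card_Un_disjoint)
  then show ?thesis
    unfolding split card_N .
qed

lemma card_filter_insert:
  assumes "finite D" "a \<notin> D"
  shows "card {e \<in> insert a D. P e} = card {e \<in> D. P e} + of_bool (P a)"
proof -
  have "{e \<in> insert a D. P e} = (if P a then insert a {e \<in> D. P e} else {e \<in> D. P e})"
    by auto
  then show ?thesis using assms by simp
qed

lemma card_filter_complementary:
  assumes "finite E" "\<And>e. e \<in> E \<Longrightarrow> P e \<noteq> Q e"
  shows "card {e \<in> E. P e} + card {e \<in> E. Q e} = card E"
proof -
  have "E = {e \<in> E. P e} \<union> {e \<in> E. Q e}" "{e \<in> E. P e} \<inter> {e \<in> E. Q e} = {}"
    using assms(2) by auto
  then show ?thesis using assms(1) by (metis card_Un_disjoint finite_Un)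
qed

text \<open>
  If all triples on the edge \<open>{a, b}\<close> have parity \<open>c\<close>, then the points of \<open>E\<close> are all
  discordant with an even number, or all with exactly one, of \<open>a\<close> and \<open>b\<close>. Which of the two
  happens depends on whether the pair \<open>{a, b}\<close> agrees with \<open>c\<close>.
\<close>

lemma discordance_degrees_parity:
  assumes "finite E" "\<And>e. e \<in> E \<Longrightarrow> odd_triple \<alpha> a b e = c"
  shows "odd (card {e \<in> E. discordant \<alpha> a e} + card {e \<in> E. discordant \<alpha> b e})
    \<longleftrightarrow> odd (card E) \<and> c \<noteq> discordant \<alpha> a b"
proof (cases "c = discordant \<alpha> a b")
  case True
  then have "{e \<in> E. discordant \<alpha> a e} = {e \<in> E. discordant \<alpha> b e}"
    using assms(2) by (auto simp: odd_triple_def)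
  then show ?thesis using True by simp
next
  case False
  then have "card {e \<in> E. discordant \<alpha> a e} + card {e \<in> E. discordant \<alpha> b e} = card E"
    using assms by (intro card_filter_complementary) (auto simp: odd_triple_def)
  then show ?thesis using False by simp
qed

text \<open>
  Removing two points \<open>a\<close> and \<open>b\<close> changes the parity by \<open>c\<close>: the remaining set \<open>E\<close> has odd
  size, so that the degrees of \<open>a\<close> and \<open>b\<close> in \<open>E\<close> together have parity \<open>c\<close> plus the parity of
  the pair \<open>{a, b}\<close>, and the pair itself is counted once more.
\<close>

lemma inversions_parity_odd_width:
  assumes "card D = 2 * k + 1"
    and "\<And>x y z. \<lbrakk>x \<in> D; y \<in> D; z \<in> D; x \<noteq> y; y \<noteq> z; x \<noteq> z\<rbrakk> \<Longrightarrow> odd_triple \<alpha> x y z = c"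
  shows "odd (card (inversions D \<alpha>)) \<longleftrightarrow> c \<and> odd k"
  using assms
proof (induction k arbitrary: D)
  case 0
  then obtain x where "D = {x}" by (auto simp: card_1_singleton_iff)
  then have "inversions D \<alpha> = {}" by (auto simp: inversions_def)
  then show ?case by simp
next
  case (Suc k)
  from Suc.prems(1) have "card D = Suc (Suc (2 * k + 1))" by simp
  then obtain a b E where D: "D = insert a (insert b E)" "a \<notin> insert b E" "b \<notin> E"
    and E: "card E = 2 * k + 1"
    by (metis card_eq_SucD)
  have fin: "finite E" using E card.infinite by fastforce
  have IH: "odd (card (inversions E \<alpha>)) \<longleftrightarrow> c \<and> odd k"
    by (rule Suc.IH[OF E], rule Suc.prems(2)) (use D in auto)
  have deg: "odd (card {e \<in> E. discordant \<alpha> a e} + card {e \<in> E. discordant \<alpha> b e})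
    \<longleftrightarrow> odd (card E) \<and> c \<noteq> discordant \<alpha> a b"
    by (rule discordance_degrees_parity[OF fin], rule Suc.prems(2)) (use D in auto)
  have "card (inversions D \<alpha>) = card (inversions E \<alpha>) + card {e \<in> E. discordant \<alpha> b e}
      + (card {e \<in> E. discordant \<alpha> a e} + of_bool (discordant \<alpha> a b))"
    using D(2,3) fin unfolding D(1)
    by (simp add: card_inversions_insert card_filter_insert del: insert_iff)
  then show ?case using IH deg E by auto
qed

lemma card_inversions_decreasing:
  assumes "finite D" "\<And>x y. \<lbrakk>x \<in> D; y \<in> D; x < y\<rbrakk> \<Longrightarrow> \<alpha> y < \<alpha> x"
  shows "card (inversions D \<alpha>) = card D choose 2"
  using assms
proof (induction D rule: finite_induct)
  case empty
  then show ?case by (simp add: inversions_def)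
next
  case (insert a D)
  have "discordant \<alpha> a e" if "e \<in> D" for e
    using insert.prems[of a e] insert.prems[of e a] insert.hyps(2) that
    by (cases a e rule: linorder_cases) (auto simp: discordant_def)
  then have "{e \<in> D. discordant \<alpha> a e} = D" by blast
  then have "card (inversions (insert a D) \<alpha>) = (card D choose 2) + card D"
    using insert by (simp add: card_inversions_insert)
  then show ?case using insert.hyps by (simp add: numeral_2_eq_2)
qed

lemma even_choose_2_iff: "even (t choose 2) \<longleftrightarrow> t mod 4 = 0 \<or> t mod 4 = 1"
proof (induction t)
  case 0
  then show ?case by (simp add: numeral_2_eq_2)
next
  case (Suc t)
  have "Suc t choose 2 = t + (t choose 2)" by (simp add: numeral_2_eq_2)
  then show ?case using Suc by simp presburger
qed

section \<open>Injective domains of mappings of rank at least n - 1\<close>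

text \<open>
  An injective set \<open>X\<close> extends to one that represents every value of \<open>\<alpha>\<close>, and this
  transversal has at least \<open>n - 1\<close> elements.
\<close>

lemma exists_disjoint_injective_extension:
  assumes rank: "n - 1 \<le> map_rank n \<alpha>" and X: "X \<subseteq> {..<n}" "inj_on \<alpha> X" "card X + m \<le> n - 1"
  obtains E where "E \<subseteq> {..<n}" "E \<inter> X = {}" "card E = m" "inj_on \<alpha> (E \<union> X)"
proof -
  \<comment> \<open>\<open>U\<close> picks one preimage of each value that \<open>\<alpha>\<close> does not take on \<open>X\<close>.\<close>
  have "\<exists>U\<subseteq>{..<n}. inj_on \<alpha> U \<and> \<alpha> ` {..<n} - \<alpha> ` X = \<alpha> ` U"
    by (rule subset_image_inj[THEN iffD1]) (rule Diff_subset)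
  then obtain U where U: "U \<subseteq> {..<n}" "inj_on \<alpha> U" "\<alpha> ` {..<n} - \<alpha> ` X = \<alpha> ` U"
    by blast
  have fX: "finite X" using X(1) finite_subset by blast
  have "card U = card (\<alpha> ` {..<n} - \<alpha> ` X)" using U(2,3) by (simp add: card_image)
  also have "\<dots> = map_rank n \<alpha> - card X"
    using X fX by (simp add: map_rank_def card_Diff_subset card_image image_mono)
  finally have "m \<le> card U" using rank X(3) by simp
  then obtain E where E: "E \<subseteq> U" "card E = m" by (meson obtain_subset_with_card_n)
  have "inj_on \<alpha> (U \<union> X)"
    using U X(2) by (auto simp: inj_on_Un)
  then have "inj_on \<alpha> (E \<union> X)" by (rule inj_on_subset) (use E(1) in auto)
  moreover have "E \<inter> X = {}" using E(1) U(3) by blast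
  moreover have "E \<subseteq> {..<n}" using E(1) U(1) by simp
  ultimately show thesis using that E(2) by simp
qed

text \<open>
  With two different colliding pairs, two points could be removed without losing a value.
\<close>

lemma unique_collision:
  assumes rank: "n - 1 \<le> map_rank n \<alpha>"
    and "x < y" "y < n" "\<alpha> x = \<alpha> y" "x' < y'" "y' < n" "\<alpha> x' = \<alpha> y'"
  shows "x = x' \<and> y = y'"
proof (rule ccontr)
  assume ne: "\<not> (x = x' \<and> y = y')"
  have "\<exists>u v. u < n \<and> v < n \<and> u \<noteq> v \<and> \<alpha> ` {..<n} \<subseteq> \<alpha> ` ({..<n} - {u, v})"
  \<comment> \<open>Remove the larger point of each pair, or both smaller ones if the larger ones coincide.\<close>
  proof (cases "y = y'")
    case True
    have "\<exists>w<n. w \<noteq> x \<and> w \<noteq> x' \<and> \<alpha> z = \<alpha> w" if "z < n" for z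
    proof (cases "z = x \<or> z = x'")
      case True
      then have "y < n \<and> y \<noteq> x \<and> y \<noteq> x' \<and> \<alpha> z = \<alpha> y" using assms \<open>y = y'\<close> by auto
      then show ?thesis by blast
    next
      case False
      then show ?thesis using that by blast
    qed
    then have "\<alpha> ` {..<n} \<subseteq> \<alpha> ` ({..<n} - {x, x'})" by (fastforce simp: image_iff)
    then show ?thesis using True ne assms
      by (intro exI[of _ x] exI[of _ x']) auto
  next
    case False
    have "\<exists>w<n. w \<noteq> y \<and> w \<noteq> y' \<and> \<alpha> z = \<alpha> w" if "z < n" for z
    proof -
      consider "z = y" "x \<noteq> y'" | "z = y" "x = y'" | "z = y'" "x' \<noteq> y" | "z = y'" "x' = y"
        | "z \<noteq> y" "z \<noteq> y'" by blast
      then show ?thesis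
      proof cases
        case 1 then show ?thesis using assms by (intro exI[of _ x]) auto
      next
        case 2 then show ?thesis using assms by (intro exI[of _ x']) auto
      next
        case 3 then show ?thesis using assms by (intro exI[of _ x']) auto
      next
        case 4 then show ?thesis using assms by (intro exI[of _ x]) auto
      next
        case 5 then show ?thesis using that by blast
      qed
    qed
    then have "\<alpha> ` {..<n} \<subseteq> \<alpha> ` ({..<n} - {y, y'})" by (fastforce simp: image_iff)
    then show ?thesis using False assms by blast
  qed
  then obtain u v where uv: "u < n" "v < n" "u \<noteq> v" "\<alpha> ` {..<n} \<subseteq> \<alpha> ` ({..<n} - {u, v})"
    by blast
  have "map_rank n \<alpha> \<le> card (\<alpha> ` ({..<n} - {u, v}))"
    unfolding map_rank_def by (rule card_mono) (use uv in auto)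
  also have "\<dots> \<le> card ({..<n} - {u, v})" by (rule card_image_le) simp
  also have "\<dots> = n - 2" using uv by (subst card_Diff_subset) auto
  finally show False using rank uv by linarith
qed

text \<open>
  These points serve as a reference triple: an injective triple stays injective when one of
  its points is replaced by an uncollided one.
\<close>

lemma three_uncollided_points:
  assumes rank: "n - 1 \<le> map_rank n \<alpha>" and "5 \<le> n"
  obtains u v w where "u < n" "v < n" "w < n" "u \<noteq> v" "v \<noteq> w" "u \<noteq> w"
    "\<forall>p\<in>{u, v, w}. \<forall>x<n. x \<noteq> p \<longrightarrow> \<alpha> x \<noteq> \<alpha> p"
proof -
  have "\<exists>p q. \<forall>x y. x < y \<and> y < n \<and> \<alpha> x = \<alpha> y \<longrightarrow> x = p \<and> y = q"
    using unique_collision[OF rank] by blast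
  then obtain p q where pq: "\<And>x y. \<lbrakk>x < y; y < n; \<alpha> x = \<alpha> y\<rbrakk> \<Longrightarrow> x = p \<and> y = q"
    by blast
  have "card {..<n} - card {p, q} \<le> card ({..<n} - {p, q})"
    by (rule diff_card_le_card_Diff) simp
  moreover have "card {p, q} \<le> 2" by (simp add: card_insert_if)
  ultimately have "3 \<le> card ({..<n} - {p, q})" using \<open>5 \<le> n\<close> by simp
  then obtain U where U: "U \<subseteq> {..<n} - {p, q}" "card U = 3" by (meson obtain_subset_with_card_n)
  then obtain u v w where uvw: "U = {u, v, w}" "u \<noteq> v" "v \<noteq> w" "u \<noteq> w" by (auto simp: card_3_iff)
  have "\<alpha> x \<noteq> \<alpha> r" if r: "r \<in> {u, v, w}" and "x < n" "x \<noteq> r" for x r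
  proof
    assume eq: "\<alpha> x = \<alpha> r"
    have "r < n" "r \<noteq> p" "r \<noteq> q" using r U(1) uvw(1) by auto
    then show False using pq[of x r] pq[of r x] eq that by (metis nat_neq_iff)
  qed
  then show thesis using that U(1) uvw by auto
qed

section \<open>All injective triples of a generator have the same parity\<close>

text \<open>
  \<open>E \<union> {a}\<close> and \<open>E \<union> {b}\<close> are injective sets of size \<open>t\<close>, hence both even, and they share the
  inversions inside \<open>E\<close>.
\<close>

lemma Delta_gens_degree_parity:
  assumes gen: "\<alpha> \<in> Delta_gens n t" and "1 \<le> t"
    and "E \<subseteq> {..<n}" "a < n" "b < n" "a \<notin> E" "b \<notin> E" "card E = t - 1"
    and inj: "inj_on \<alpha> (insert a (insert b E))"
  shows "even (card {e \<in> E. discordant \<alpha> a e} + card {e \<in> E. discordant \<alpha> b e})"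
proof -
  have fin: "finite E" using assms(3) finite_subset by blast
  have "even (card (inversions (insert c E) \<alpha>))" if "c \<in> {a, b}" for c
  proof -
    have "inj_on \<alpha> (insert c E)" using inj that by (auto intro: inj_on_subset)
    moreover have "card (insert c E) = t" "insert c E \<subseteq> {..<n}" using that assms fin by auto
    ultimately show ?thesis using gen by (auto simp: Delta_gens_def even_on_def)
  qed
  from this[of a] this[of b] show ?thesis using assms fin by (auto simp: card_inversions_insert)
qed

text \<open>
  Enlarging a set \<open>E\<close> of size \<open>t - 2\<close> by \<open>c\<close> and by \<open>d\<close> gives two degree conditions on \<open>a\<close>
  and \<open>b\<close>. In their sum the contribution of \<open>E\<close> cancels.
\<close>

lemma Delta_gens_exchange:
  assumes gen: "\<alpha> \<in> Delta_gens n t" and t: "2 \<le> t" "t + 3 \<le> n"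
    and lt: "a < n" "b < n" "c < n" "d < n"
    and dist: "distinct [a, b, c, d]" and inj: "inj_on \<alpha> {a, b, c, d}"
  shows "odd_triple \<alpha> a b c = odd_triple \<alpha> a b d"
proof -
  have rank: "n - 1 \<le> map_rank n \<alpha>" using gen by (simp add: Delta_gens_def)
  have "card {a, b, c, d} = 4" using dist by simp
  then have le: "card {a, b, c, d} + (t - 2) \<le> n - 1" using t by linarith
  have "{a, b, c, d} \<subseteq> {..<n}" using lt by simp
  then obtain E where E: "E \<subseteq> {..<n}" "E \<inter> {a, b, c, d} = {}" "card E = t - 2"
      "inj_on \<alpha> (E \<union> {a, b, c, d})"
    by (rule exists_disjoint_injective_extension[OF rank _ inj le])
  have fin: "finite E" using E(1) finite_subset by blast
  let ?s = "card {e \<in> E. discordant \<alpha> a e} + card {e \<in> E. discordant \<alpha> b e}"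
  have "even (?s + of_bool (discordant \<alpha> a x) + of_bool (discordant \<alpha> b x))" if "x \<in> {c, d}" for x
  proof -
    have "even (card {e \<in> insert x E. discordant \<alpha> a e} + card {e \<in> insert x E. discordant \<alpha> b e})"
    proof (rule Delta_gens_degree_parity[OF gen])
      show "inj_on \<alpha> (insert a (insert b (insert x E)))"
        using E(4) by (rule inj_on_subset) (use that in auto)
      show "card (insert x E) = t - 1" using that E fin t by auto
    qed (use that dist E t lt in auto)
    moreover have "x \<notin> E" using that E by auto
    ultimately show ?thesis using fin
      by (simp add: card_filter_insert algebra_simps del: insert_iff)
  qed
  from this[of c] this[of d] show ?thesis by (auto simp: odd_triple_def)
qed

text \<open>
  The reference triple \<open>{u, v, w}\<close> consists of uncollided points. Every injective triple is
  turned into it by bringing in \<open>u\<close>, \<open>v\<close> and \<open>w\<close> one after the other.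
\<close>

lemma Delta_gens_triples_constant:
  assumes gen: "\<alpha> \<in> Delta_gens n t" and t: "2 \<le> t" "t + 3 \<le> n"
  obtains c where "\<forall>x<n. \<forall>y<n. \<forall>z<n.
      \<alpha> x \<noteq> \<alpha> y \<and> \<alpha> y \<noteq> \<alpha> z \<and> \<alpha> x \<noteq> \<alpha> z \<longrightarrow> odd_triple \<alpha> x y z = c"
proof -
  have rank: "n - 1 \<le> map_rank n \<alpha>" using gen by (simp add: Delta_gens_def)
  have n5: "5 \<le> n" using t by simp
  obtain u v w where uvw: "u < n" "v < n" "w < n" "u \<noteq> v" "v \<noteq> w" "u \<noteq> w"
    and "\<forall>p\<in>{u, v, w}. \<forall>x<n. x \<noteq> p \<longrightarrow> \<alpha> x \<noteq> \<alpha> p"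
    by (rule three_uncollided_points[OF rank n5])
  then have unc: "\<alpha> x \<noteq> \<alpha> p" if "p \<in> {u, v, w}" "x < n" "x \<noteq> p" for x p
    using that by blast
  define inj3 where "inj3 x y z \<longleftrightarrow> x < n \<and> y < n \<and> z < n \<and> \<alpha> x \<noteq> \<alpha> y \<and> \<alpha> y \<noteq> \<alpha> z \<and> \<alpha> x \<noteq> \<alpha> z"
    for x y z
  have swap: "odd_triple \<alpha> x y z = odd_triple \<alpha> x y p \<and> inj3 x y p"
    if "inj3 x y z" "p \<in> {u, v, w}" "p \<noteq> x" "p \<noteq> y" for x y z p
  proof (cases "z = p")
    case True
    then show ?thesis using that by simp
  next
    case False
    have p: "p < n" using that(2) uvw by auto
    then have "inj3 x y p" "inj_on \<alpha> {x, y, z, p}" "distinct [x, y, z, p]"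
      using that False unc[OF that(2)] unfolding inj3_def inj_on_def by (auto, metis+)
    then show ?thesis
      using Delta_gens_exchange[OF gen t, of x y z p] that p by (auto simp: inj3_def)
  qed
  have "odd_triple \<alpha> x y z = odd_triple \<alpha> u v w" if xyz: "inj3 x y z" for x y z
  proof -
    have perm: "inj3 a b c \<Longrightarrow> inj3 b a c" "inj3 a b c \<Longrightarrow> inj3 a c b" for a b c
      unfolding inj3_def by metis+
    have "\<exists>y' z'. inj3 u y' z' \<and> odd_triple \<alpha> x y z = odd_triple \<alpha> u y' z'"
    proof (cases "u \<in> {x, y}")
      case True
      then show ?thesis using xyz perm odd_triple_permute by blast
    next
      case False
      then show ?thesis using swap[OF xyz, of u] perm odd_triple_permute by blast
    qed
    then obtain y' z' where 1: "inj3 u y' z'" "odd_triple \<alpha> x y z = odd_triple \<alpha> u y' z'" by blast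
    have "\<exists>z''. inj3 u v z'' \<and> odd_triple \<alpha> u y' z' = odd_triple \<alpha> u v z''"
    proof (cases "v = y'")
      case True
      then show ?thesis using 1(1) by blast
    next
      case False
      then show ?thesis using swap[OF 1(1), of v] uvw(4) perm odd_triple_permute by blast
    qed
    then obtain z'' where 2: "inj3 u v z''" "odd_triple \<alpha> u y' z' = odd_triple \<alpha> u v z''" by blast
    show ?thesis using swap[OF 2(1), of w] uvw 1 2 by auto
  qed
  then show thesis
    by (intro that[of "odd_triple \<alpha> u v w"] allI impI) (simp add: inj3_def)
qed

section \<open>Cuts and the reversal\<close>

definition reversal :: "nat \<Rightarrow> nat \<Rightarrow> nat" where
  "reversal n = (\<lambda>x\<in>{..<n}. n - 1 - x)"

text \<open>
  The rotation goes down by one, so that composing with it on the right moves a cut up by one.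
\<close>

definition rotation :: "nat \<Rightarrow> nat \<Rightarrow> nat" where
  "rotation n = (\<lambda>x\<in>{..<n}. if x = 0 then n - 1 else x - 1)"

text \<open>
  The values do not decrease on \<open>{..<k}\<close> and on \<open>{k..<n}\<close>, and all values on the second
  block are at most those on the first. In contrast to the count of cyclic descents, this
  condition is easy to transport along compositions.
\<close>

definition cut_at :: "nat \<Rightarrow> nat \<Rightarrow> (nat \<Rightarrow> nat) \<Rightarrow> bool" where
  "cut_at n k \<alpha> \<longleftrightarrow>
     (\<forall>x y. x < y \<and> y < n \<longrightarrow> (if x < k \<and> k \<le> y then \<alpha> y \<le> \<alpha> x else \<alpha> x \<le> \<alpha> y))"

lemma mappings_less: "\<alpha> \<in> mappings n \<Longrightarrow> x < n \<Longrightarrow> \<alpha> x < n"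
  by (auto simp: mappings_def)

lemma mappings_eqI:
  "\<lbrakk>\<alpha> \<in> mappings n; \<beta> \<in> mappings n; \<And>x. x < n \<Longrightarrow> \<alpha> x = \<beta> x\<rbrakk> \<Longrightarrow> \<alpha> = \<beta>"
  unfolding mappings_def by (rule PiE_ext) auto

lemma compose_in_mappings:
  "\<alpha> \<in> mappings n \<Longrightarrow> \<beta> \<in> mappings n \<Longrightarrow> compose {..<n} \<alpha> \<beta> \<in> mappings n"
  by (auto simp: mappings_def compose_def)

lemma compose_below: "x < n \<Longrightarrow> compose {..<n} \<alpha> \<beta> x = \<alpha> (\<beta> x)"
  by (simp add: compose_def)

lemma compose_assoc_mappings:
  assumes "\<gamma> \<in> mappings n"
  shows "compose {..<n} (compose {..<n} \<alpha> \<beta>) \<gamma> = compose {..<n} \<alpha> (compose {..<n} \<beta> \<gamma>)"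
  using mappings_less[OF assms] by (auto simp: compose_def)

lemma reversal_in_mappings: "reversal n \<in> mappings n"
  by (auto simp: reversal_def mappings_def)

lemma rotation_in_mappings: "rotation n \<in> mappings n"
  by (auto simp: rotation_def mappings_def)

lemma compose_reversal_involution:
  assumes "\<alpha> \<in> mappings n"
  shows "compose {..<n} (reversal n) (compose {..<n} (reversal n) \<alpha>) = \<alpha>"
proof (rule mappings_eqI[OF _ assms])
  show "compose {..<n} (reversal n) (compose {..<n} (reversal n) \<alpha>) \<in> mappings n"
    using assms by (simp add: compose_in_mappings reversal_in_mappings)
  show "compose {..<n} (reversal n) (compose {..<n} (reversal n) \<alpha>) x = \<alpha> x" if "x < n" for x
    using mappings_less[OF assms that] that by (simp add: compose_below reversal_def)
qed

lemma order_preserving_iff_nondecreasing: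
  "order_preserving n \<alpha> \<longleftrightarrow> (\<forall>x y. x < y \<and> y < n \<longrightarrow> \<alpha> x \<le> \<alpha> y)"
  by (auto simp: order_preserving_def monotone_on_def)

lemma order_preserving_iff_cut_at_0: "order_preserving n \<alpha> \<longleftrightarrow> cut_at n 0 \<alpha>"
  by (auto simp: order_preserving_iff_nondecreasing cut_at_def)

lemma order_preserving_iff_cut_at_n: "order_preserving n \<alpha> \<longleftrightarrow> cut_at n n \<alpha>"
  by (auto simp: order_preserving_iff_nondecreasing cut_at_def)

lemma order_reversing_iff_reversal:
  assumes "\<alpha> \<in> mappings n"
  shows "order_reversing n \<alpha> \<longleftrightarrow> order_preserving n (compose {..<n} (reversal n) \<alpha>)"
proof -
  have "reversal n (\<alpha> x) \<le> reversal n (\<alpha> y) \<longleftrightarrow> \<alpha> y \<le> \<alpha> x" if "x < n" "y < n" for x y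
    using mappings_less[OF assms that(1)] mappings_less[OF assms that(2)]
    by (auto simp: reversal_def)
  then show ?thesis
    by (simp add: order_reversing_def order_preserving_def monotone_on_def compose_below)
qed

lemma nondecreasing_on_segment:
  fixes \<alpha> :: "nat \<Rightarrow> nat"
  assumes "\<And>i. \<lbrakk>a \<le> i; Suc i < b\<rbrakk> \<Longrightarrow> \<alpha> i \<le> \<alpha> (Suc i)" and "a \<le> x" "x \<le> y" "y < b"
  shows "\<alpha> x \<le> \<alpha> y"
  using assms(3,4)
proof (induction y rule: dec_induct)
  case (step m)
  then show ?case using assms(1)[of m] assms(2) by simp
qed simp

text \<open>
  The cut is placed directly behind the only cyclic descent. That there is no further
  descent from the last to the first entry puts the second block below the first.
\<close>

lemma cyclic_seq_iff_cut_at: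
  assumes "0 < n"
  shows "cyclic_seq (map \<alpha> [0..<n]) \<longleftrightarrow> (\<exists>k\<le>n. cut_at n k \<alpha>)"
proof -
  define Ds where "Ds = {i. i < n \<and> \<alpha> i > \<alpha> (Suc i mod n)}"
  have cyc: "cyclic_seq (map \<alpha> [0..<n]) \<longleftrightarrow> card Ds \<le> 1"
  proof -
    have "{i. i < n \<and> map \<alpha> [0..<n] ! i > map \<alpha> [0..<n] ! (Suc i mod n)} = Ds"
      using assms by (auto simp: Ds_def)
    then show ?thesis by (simp add: cyclic_seq_def)
  qed
  have fin: "finite Ds" by (simp add: Ds_def)
  show ?thesis unfolding cyc
  proof
    assume "card Ds \<le> 1"
    then have "\<exists>i. Ds \<subseteq> {i} \<and> i < n"
      using fin assms by (cases "Ds = {}") (auto simp: Ds_def card_le_Suc0_iff_eq)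
    then obtain i where i: "Ds \<subseteq> {i}" "i < n" by blast
    then have step: "\<alpha> j \<le> \<alpha> (Suc j mod n)" if "j \<noteq> i" "j < n" for j
      using that i unfolding Ds_def by (auto simp: not_less[symmetric])
    have left: "\<alpha> x \<le> \<alpha> y" if "x \<le> y" "y < Suc i" for x y
    proof (rule nondecreasing_on_segment[where \<alpha> = \<alpha> and a = 0 and b = "Suc i"])
      show "\<alpha> j \<le> \<alpha> (Suc j)" if "0 \<le> j" "Suc j < Suc i" for j
        using step[of j] that i by simp
    qed (use that in auto)
    have right: "\<alpha> x \<le> \<alpha> y" if "Suc i \<le> x" "x \<le> y" "y < n" for x y
    proof (rule nondecreasing_on_segment[where \<alpha> = \<alpha> and a = "Suc i" and b = n])
      show "\<alpha> j \<le> \<alpha> (Suc j)" if "Suc i \<le> j" "Suc j < n" for j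
        using step[of j] that i by simp
    qed (use that in auto)
    have wrap: "\<alpha> y \<le> \<alpha> x" if "x < Suc i" "Suc i \<le> y" "y < n" for x y
    proof -
      have "\<alpha> y \<le> \<alpha> (n - 1)" by (rule right) (use that in auto)
      also have "\<alpha> (n - 1) \<le> \<alpha> 0" using step[of "n - 1"] that by simp
      also have "\<alpha> 0 \<le> \<alpha> x" by (rule left) (use that in auto)
      finally show ?thesis .
    qed
    have "cut_at n (Suc i) \<alpha>"
      unfolding cut_at_def using left right wrap by (auto simp: not_less not_le)
    then show "\<exists>k\<le>n. cut_at n k \<alpha>" using i by (auto intro: exI[of _ "Suc i"])
  next
    assume "\<exists>k\<le>n. cut_at n k \<alpha>"
    then obtain k where k: "k \<le> n" "cut_at n k \<alpha>" by blast
    \<comment> \<open>A cut at \<open>0\<close> leaves room for one descent, from the last position back to the first.\<close>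
    have "i = (if k = 0 then n - 1 else k - 1)" if i: "i < n" "\<alpha> i > \<alpha> (Suc i mod n)" for i
    proof (cases "Suc i < n")
      case True
      then show ?thesis using i k(2)[unfolded cut_at_def, rule_format, of i "Suc i"]
        by (auto split: if_splits)
    next
      case False
      then have "i = n - 1" "\<alpha> i > \<alpha> 0" using i by (auto simp: le_less_Suc_eq not_less_eq)
      then show ?thesis using k i k(2)[unfolded cut_at_def, rule_format, of 0 "n - 1"]
        by (cases "n = 1") (auto split: if_splits)
    qed
    then have "Ds \<subseteq> {if k = 0 then n - 1 else k - 1}" unfolding Ds_def by blast
    then show "card Ds \<le> 1" using card_mono[of "{if k = 0 then n - 1 else k - 1}" Ds] by simp
  qed
qed

lemma OP_maps_eq: "0 < n \<Longrightarrow> OP_maps n = {\<alpha> \<in> mappings n. \<exists>k\<le>n. cut_at n k \<alpha>}"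
  by (simp add: OP_maps_def cyclic_seq_iff_cut_at)

lemma anti_cyclic_seq_iff_reversal:
  assumes "\<alpha> \<in> mappings n"
  shows "anti_cyclic_seq (map \<alpha> [0..<n])
    \<longleftrightarrow> cyclic_seq (map (compose {..<n} (reversal n) \<alpha>) [0..<n])"
proof -
  have "reversal n (\<alpha> x) < reversal n (\<alpha> y) \<longleftrightarrow> \<alpha> y < \<alpha> x" if "x < n" "y < n" for x y
    using mappings_less[OF assms that(1)] mappings_less[OF assms that(2)]
    by (auto simp: reversal_def)
  then have "{i. i < n \<and> map \<alpha> [0..<n] ! i < map \<alpha> [0..<n] ! (Suc i mod n)} =
     {i. i < n \<and> map (compose {..<n} (reversal n) \<alpha>) [0..<n] ! i
       > map (compose {..<n} (reversal n) \<alpha>) [0..<n] ! (Suc i mod n)}"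
    by (auto simp: compose_below)
  then show ?thesis by (simp add: anti_cyclic_seq_def cyclic_seq_def)
qed

lemma reversal_image_iff:
  assumes "A \<subseteq> mappings n" "\<alpha> \<in> mappings n"
  shows "\<alpha> \<in> compose {..<n} (reversal n) ` A \<longleftrightarrow> compose {..<n} (reversal n) \<alpha> \<in> A"
proof
  show "compose {..<n} (reversal n) \<alpha> \<in> A" if "\<alpha> \<in> compose {..<n} (reversal n) ` A"
    using that assms(1) compose_reversal_involution by auto
  show "\<alpha> \<in> compose {..<n} (reversal n) ` A" if "compose {..<n} (reversal n) \<alpha> \<in> A"
    by (rule image_eqI[where f = "compose {..<n} (reversal n)", OF _ that])
      (simp add: compose_reversal_involution[OF assms(2)])
qed

lemma M_maps_eq: "M_maps n = O_maps n \<union> compose {..<n} (reversal n) ` O_maps n"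
proof (rule set_eqI)
  fix \<alpha>
  have sub: "O_maps n \<subseteq> mappings n" by (auto simp: O_maps_def)
  show "\<alpha> \<in> M_maps n \<longleftrightarrow> \<alpha> \<in> O_maps n \<union> compose {..<n} (reversal n) ` O_maps n"
  proof (cases "\<alpha> \<in> mappings n")
    case True
    then show ?thesis
      unfolding Un_iff reversal_image_iff[OF sub True]
      by (simp add: M_maps_def O_maps_def order_reversing_iff_reversal
          compose_in_mappings reversal_in_mappings)
  next
    case False
    then have "\<alpha> \<notin> compose {..<n} (reversal n) ` O_maps n"
      using compose_in_mappings[OF reversal_in_mappings] sub by blast
    with False show ?thesis using sub by (auto simp: M_maps_def)
  qed
qed

lemma OR_maps_eq: "OR_maps n = OP_maps n \<union> compose {..<n} (reversal n) ` OP_maps n"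
proof (rule set_eqI)
  fix \<alpha>
  have sub: "OP_maps n \<subseteq> mappings n" by (auto simp: OP_maps_def)
  show "\<alpha> \<in> OR_maps n \<longleftrightarrow> \<alpha> \<in> OP_maps n \<union> compose {..<n} (reversal n) ` OP_maps n"
  proof (cases "\<alpha> \<in> mappings n")
    case True
    then show ?thesis
      unfolding Un_iff reversal_image_iff[OF sub True]
      by (simp add: OR_maps_def OP_maps_def oriented_seq_def anti_cyclic_seq_iff_reversal
          compose_in_mappings reversal_in_mappings)
  next
    case False
    then have "\<alpha> \<notin> compose {..<n} (reversal n) ` OP_maps n"
      using compose_in_mappings[OF reversal_in_mappings] sub by blast
    with False show ?thesis using sub by (auto simp: OR_maps_def)
  qed
qed

section \<open>Closure under composition\<close>

lemma O_maps_compose: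
  assumes "\<alpha> \<in> O_maps n" "\<beta> \<in> O_maps n"
  shows "compose {..<n} \<alpha> \<beta> \<in> O_maps n"
proof -
  have "\<alpha> (\<beta> x) \<le> \<alpha> (\<beta> y)" if "x < y" "y < n" for x y
    using assms that mappings_less[of \<beta> n y]
    by (cases "\<beta> x = \<beta> y") (auto simp: O_maps_def order_preserving_iff_nondecreasing le_less)
  then show ?thesis
    using assms by (simp add: O_maps_def order_preserving_iff_nondecreasing compose_below compose_in_mappings)
qed

lemma cut_at_cong:
  "(\<And>x. x < n \<Longrightarrow> \<alpha> x = \<beta> x) \<Longrightarrow> cut_at n k \<alpha> = cut_at n k \<beta>"
  by (auto simp: cut_at_def)

lemma cut_at_shift:
  assumes "cut_at n (Suc k) \<alpha>" "k < n"
  shows "cut_at n k (\<lambda>x. \<alpha> (if Suc x = n then 0 else Suc x))"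
  unfolding cut_at_def
proof (intro allI impI)
  note cut = assms(1)[unfolded cut_at_def, rule_format]
  fix x y assume "x < y \<and> y < n"
  then show "if x < k \<and> k \<le> y
      then \<alpha> (if Suc y = n then 0 else Suc y) \<le> \<alpha> (if Suc x = n then 0 else Suc x)
      else \<alpha> (if Suc x = n then 0 else Suc x) \<le> \<alpha> (if Suc y = n then 0 else Suc y)"
    using cut[of "Suc x" "Suc y"] cut[of 0 "Suc x"] assms(2) by (auto split: if_splits)
qed

lemma cut_at_rotation:
  assumes "cut_at n k \<alpha>" "k < n"
  shows "cut_at n (Suc k) (\<lambda>x. \<alpha> (rotation n x))"
  unfolding cut_at_def
proof (intro allI impI)
  note cut = assms(1)[unfolded cut_at_def, rule_format]
  fix x y assume "x < y \<and> y < n"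
  moreover from this obtain y' n' where "y = Suc y'" "n = Suc n'"
    by (cases y; cases n) auto
  ultimately show "if x < Suc k \<and> Suc k \<le> y then \<alpha> (rotation n y) \<le> \<alpha> (rotation n x)
      else \<alpha> (rotation n x) \<le> \<alpha> (rotation n y)"
    using cut[of "x - 1" y'] cut[of y' n'] assms(2)
    by (cases x) (auto simp: rotation_def split: if_splits)
qed

lemma cut_map_rotation_factor:
  assumes \<alpha>: "\<alpha> \<in> mappings n" and cut: "cut_at n (Suc k) \<alpha>" and "k < n"
  obtains \<beta> where "\<beta> \<in> mappings n" "cut_at n k \<beta>" "\<alpha> = compose {..<n} \<beta> (rotation n)"
proof
  let ?\<beta> = "\<lambda>x\<in>{..<n}. \<alpha> (if Suc x = n then 0 else Suc x)"
  show \<beta>: "?\<beta> \<in> mappings n" using mappings_less[OF \<alpha>] by (auto simp: mappings_def)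
  show "cut_at n k ?\<beta>"
    using cut_at_shift[OF cut \<open>k < n\<close>] by (simp cong: cut_at_cong)
  show "\<alpha> = compose {..<n} ?\<beta> (rotation n)"
    by (rule mappings_eqI[OF \<alpha> compose_in_mappings[OF \<beta> rotation_in_mappings]])
      (auto simp: compose_below rotation_def)
qed

text \<open>
  Undoing one rotation moves the cut one place down, and a mapping with cut \<open>0\<close> is
  order-preserving. Hence orientation-preserving mappings are order-preserving ones preceded
  by rotations.
\<close>

lemma cut_map_induct [consumes 3, case_names order_preserving rotation]:
  assumes "\<alpha> \<in> mappings n" "cut_at n k \<alpha>" "k \<le> n"
    and "\<And>\<beta>. \<beta> \<in> O_maps n \<Longrightarrow> P \<beta>"
    and "\<And>\<beta>. \<lbrakk>\<beta> \<in> mappings n; P \<beta>\<rbrakk> \<Longrightarrow> P (compose {..<n} \<beta> (rotation n))"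
  shows "P \<alpha>"
  using assms(1-3)
proof (induction k arbitrary: \<alpha>)
  case 0
  then show ?case using assms(4) by (simp add: O_maps_def order_preserving_iff_cut_at_0)
next
  case (Suc k)
  then obtain \<beta> where "\<beta> \<in> mappings n" "cut_at n k \<beta>" "\<alpha> = compose {..<n} \<beta> (rotation n)"
    by (meson Suc_le_lessD cut_map_rotation_factor)
  then show ?case using Suc.IH Suc.prems(3) assms(5) by simp
qed

lemma OP_maps_compose_rotation:
  assumes "0 < n" "\<alpha> \<in> OP_maps n"
  shows "compose {..<n} \<alpha> (rotation n) \<in> OP_maps n"
proof -
  obtain k where k: "k \<le> n" "cut_at n k \<alpha>" and \<alpha>: "\<alpha> \<in> mappings n"
    using assms by (auto simp: OP_maps_eq)
  have "\<exists>k<n. cut_at n k \<alpha>"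
  proof (cases "k = n")
    case True
    then have "cut_at n 0 \<alpha>"
      using k(2) order_preserving_iff_cut_at_0 order_preserving_iff_cut_at_n by blast
    then show ?thesis using assms(1) by blast
  next
    case False
    then show ?thesis using k by (auto simp: le_less)
  qed
  then obtain k' where "k' < n" "cut_at n k' \<alpha>" by blast
  then have "cut_at n (Suc k') (compose {..<n} \<alpha> (rotation n))" "Suc k' \<le> n"
    using cut_at_rotation[of n k' \<alpha>] by (auto simp: cut_at_def compose_below)
  then show ?thesis
    using assms(1) \<alpha> by (auto simp: OP_maps_eq compose_in_mappings rotation_in_mappings)
qed

text \<open>
  The cut of the product is the first point whose image under \<open>\<beta>\<close> reaches the cut of \<open>\<alpha>\<close>.
\<close>

lemma OP_maps_compose_O_maps:
  assumes "0 < n" "\<alpha> \<in> OP_maps n" "\<beta> \<in> O_maps n"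
  shows "compose {..<n} \<alpha> \<beta> \<in> OP_maps n"
proof -
  obtain k where k: "k \<le> n" "cut_at n k \<alpha>" and \<alpha>: "\<alpha> \<in> mappings n"
    using assms by (auto simp: OP_maps_eq)
  have \<beta>: "\<beta> \<in> mappings n" and mono: "\<And>x y. \<lbrakk>x < y; y < n\<rbrakk> \<Longrightarrow> \<beta> x \<le> \<beta> y"
    using assms(3) by (auto simp: O_maps_def order_preserving_iff_nondecreasing)
  \<comment> \<open>The alternative \<open>j = n\<close> covers the case that \<open>\<beta>\<close> stays below the cut.\<close>
  define j where "j = (LEAST j. j = n \<or> k \<le> \<beta> j)"
  have j: "j = n \<or> k \<le> \<beta> j" unfolding j_def by (rule LeastI[of _ n]) simp
  have below: "\<beta> x < k" if "x < j" for x
    using not_less_Least[of x "\<lambda>j. j = n \<or> k \<le> \<beta> j"] that unfolding j_def by auto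
  have "j \<le> n" unfolding j_def by (rule Least_le) simp
  have above: "k \<le> \<beta> x" if "j \<le> x" "x < n" for x
    using j mono[of j x] that by (cases "j = x") auto
  have "cut_at n j (compose {..<n} \<alpha> \<beta>)"
    unfolding cut_at_def
  proof (intro allI impI)
    fix x y assume xy: "x < y \<and> y < n"
    then have "\<beta> x \<le> \<beta> y" "\<beta> y < n" using mono mappings_less[OF \<beta>] by auto
    moreover have "x < j \<longleftrightarrow> \<beta> x < k" "j \<le> y \<longleftrightarrow> k \<le> \<beta> y"
      using below above xy by (meson leD leI less_trans)+
    ultimately show "if x < j \<and> j \<le> y then compose {..<n} \<alpha> \<beta> y \<le> compose {..<n} \<alpha> \<beta> x
        else compose {..<n} \<alpha> \<beta> x \<le> compose {..<n} \<alpha> \<beta> y"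
      using k(2)[unfolded cut_at_def, rule_format, of "\<beta> x" "\<beta> y"] xy
      by (cases "\<beta> x = \<beta> y") (auto simp: compose_below)
  qed
  then show ?thesis using assms(1) \<alpha> \<beta> \<open>j \<le> n\<close> by (auto simp: OP_maps_eq compose_in_mappings)
qed

lemma OP_maps_compose:
  assumes n: "0 < n" and \<alpha>: "\<alpha> \<in> OP_maps n" and "\<beta> \<in> OP_maps n"
  shows "compose {..<n} \<alpha> \<beta> \<in> OP_maps n"
proof -
  obtain k where "k \<le> n" "cut_at n k \<beta>" "\<beta> \<in> mappings n"
    using assms by (auto simp: OP_maps_eq)
  from this(3,2,1) show ?thesis
  proof (induction rule: cut_map_induct)
    case (order_preserving \<beta>)
    then show ?case using OP_maps_compose_O_maps[OF n \<alpha>] by simp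
  next
    case (rotation \<beta>)
    then show ?case
      using OP_maps_compose_rotation[OF n] compose_assoc_mappings[OF rotation_in_mappings] by metis
  qed
qed

lemma conj_reversal_below:
  assumes "\<beta> \<in> mappings n" "x < n"
  shows "compose {..<n} (compose {..<n} (reversal n) \<beta>) (reversal n) x = n - 1 - \<beta> (n - 1 - x)"
  using mappings_less[OF assms(1), of "n - 1 - x"] assms(2)
  by (simp add: compose_below reversal_def compose_def)

lemma cut_at_conj_reversal:
  assumes "\<beta> \<in> mappings n" "cut_at n k \<beta>" "k \<le> n"
  shows "cut_at n (n - k) (compose {..<n} (compose {..<n} (reversal n) \<beta>) (reversal n))"
  unfolding cut_at_def
proof (intro allI impI)
  fix x y assume xy: "x < y \<and> y < n"
  let ?x = "n - 1 - x" and ?y = "n - 1 - y"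
  have "?y < ?x" "?x < n" "x < n - k \<longleftrightarrow> k \<le> ?x" "n - k \<le> y \<longleftrightarrow> ?y < k"
    using xy assms(3) by auto
  moreover from this have "if ?y < k \<and> k \<le> ?x then \<beta> ?x \<le> \<beta> ?y else \<beta> ?y \<le> \<beta> ?x"
    using assms(2) unfolding cut_at_def by blast
  ultimately show "if x < n - k \<and> n - k \<le> y
      then compose {..<n} (compose {..<n} (reversal n) \<beta>) (reversal n) y
        \<le> compose {..<n} (compose {..<n} (reversal n) \<beta>) (reversal n) x
      else compose {..<n} (compose {..<n} (reversal n) \<beta>) (reversal n) x
        \<le> compose {..<n} (compose {..<n} (reversal n) \<beta>) (reversal n) y"
    using xy by (auto simp: conj_reversal_below[OF assms(1)] intro: diff_le_mono2)
qed

lemma O_maps_conj_reversal: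
  assumes "\<beta> \<in> O_maps n"
  shows "compose {..<n} (compose {..<n} (reversal n) \<beta>) (reversal n) \<in> O_maps n"
  using cut_at_conj_reversal[of \<beta> n 0] assms
  by (auto simp: O_maps_def order_preserving_iff_cut_at_0 order_preserving_iff_cut_at_n[symmetric]
      compose_in_mappings reversal_in_mappings simp flip: order_preserving_iff_cut_at_0)

lemma OP_maps_conj_reversal:
  assumes "0 < n" "\<beta> \<in> OP_maps n"
  shows "compose {..<n} (compose {..<n} (reversal n) \<beta>) (reversal n) \<in> OP_maps n"
proof -
  obtain k where "k \<le> n" "cut_at n k \<beta>" "\<beta> \<in> mappings n"
    using assms by (auto simp: OP_maps_eq)
  then have "cut_at n (n - k) (compose {..<n} (compose {..<n} (reversal n) \<beta>) (reversal n))"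
    by (intro cut_at_conj_reversal)
  then show ?thesis
    using \<open>\<beta> \<in> mappings n\<close> assms(1)
    by (auto simp: OP_maps_eq compose_in_mappings reversal_in_mappings intro!: exI[of _ "n - k"])
qed

text \<open>
  Conjugation by the reversal lets it pass from the right to the left of a factor, where
  two reversals cancel. This applies to \<open>O\<^sub>n\<close>, giving \<open>M\<^sub>n\<close>, and to \<open>OP\<^sub>n\<close>, giving
  \<open>OR\<^sub>n\<close>.
\<close>

lemma adjoin_reversal_closed:
  assumes A: "A \<subseteq> mappings n"
    and closed: "\<And>\<alpha> \<beta>. \<lbrakk>\<alpha> \<in> A; \<beta> \<in> A\<rbrakk> \<Longrightarrow> compose {..<n} \<alpha> \<beta> \<in> A"
    and conj: "\<And>\<beta>. \<beta> \<in> A \<Longrightarrow> compose {..<n} (compose {..<n} (reversal n) \<beta>) (reversal n) \<in> A"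
    and mem: "\<alpha> \<in> A \<union> compose {..<n} (reversal n) ` A" "\<beta> \<in> A \<union> compose {..<n} (reversal n) ` A"
  shows "compose {..<n} \<alpha> \<beta> \<in> A \<union> compose {..<n} (reversal n) ` A"
proof -
  let ?\<sigma> = "reversal n" and ?c = "compose {..<n}"
  note assoc = compose_assoc_mappings
  have left: "?c \<alpha> \<beta> \<in> A \<union> ?c ?\<sigma> ` A" if mem': "\<alpha> \<in> A" "\<beta> \<in> A \<union> ?c ?\<sigma> ` A" for \<alpha> \<beta>
  proof (cases "\<beta> \<in> A")
    case True
    then show ?thesis using closed mem' by simp
  next
    case False
    then obtain \<beta>' where \<beta>': "\<beta>' \<in> A" "\<beta> = ?c ?\<sigma> \<beta>'" using mem' by blast
    have \<beta>'_map: "\<beta>' \<in> mappings n" using \<beta>'(1) A by blast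
    have "?c \<alpha> \<beta> = ?c (?c \<alpha> ?\<sigma>) \<beta>'" using \<beta>'(2) by (simp add: assoc[OF \<beta>'_map])
    also have "?c \<alpha> ?\<sigma> = ?c ?\<sigma> (?c (?c ?\<sigma> \<alpha>) ?\<sigma>)"
      using assoc[OF reversal_in_mappings] compose_reversal_involution compose_in_mappings
        reversal_in_mappings A mem'(1) by (metis subsetD)
    also have "?c \<dots> \<beta>' = ?c ?\<sigma> (?c (?c (?c ?\<sigma> \<alpha>) ?\<sigma>) \<beta>')"
      by (rule assoc[OF \<beta>'_map])
    finally show ?thesis using closed conj mem'(1) \<beta>'(1) by blast
  qed
  show ?thesis
  proof (cases "\<alpha> \<in> A")
    case True
    then show ?thesis using left mem by blast
  next
    case False
    then obtain \<alpha>' where \<alpha>': "\<alpha>' \<in> A" "\<alpha> = ?c ?\<sigma> \<alpha>'" using mem by blast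
    have "\<beta> \<in> mappings n" using mem(2) A compose_in_mappings[OF reversal_in_mappings] by blast
    then have eq: "?c \<alpha> \<beta> = ?c ?\<sigma> (?c \<alpha>' \<beta>)" using \<alpha>'(2) assoc by simp
    have "?c \<alpha>' \<beta> \<in> A \<union> ?c ?\<sigma> ` A" using left \<alpha>'(1) mem(2) by blast
    then show ?thesis
    proof
      assume "?c \<alpha>' \<beta> \<in> ?c ?\<sigma> ` A"
      then obtain \<gamma> where "\<gamma> \<in> A" "?c \<alpha>' \<beta> = ?c ?\<sigma> \<gamma>" by blast
      then show ?thesis using eq compose_reversal_involution A by auto
    qed (use eq in simp)
  qed
qed

section \<open>Generation by mappings of rank at least n - 1\<close>

lemma generated_monoid_subset:
  assumes "G \<subseteq> A" "(\<lambda>x\<in>{..<n}. x) \<in> A"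
    and "\<And>\<alpha> \<beta>. \<lbrakk>\<alpha> \<in> A; \<beta> \<in> A\<rbrakk> \<Longrightarrow> compose {..<n} \<alpha> \<beta> \<in> A"
  shows "generated_monoid n G \<subseteq> A"
proof
  fix \<alpha> assume "\<alpha> \<in> generated_monoid n G"
  then show "\<alpha> \<in> A" by induction (use assms in blast)+
qed

lemma identity_in_O_maps: "(\<lambda>x\<in>{..<n}. x) \<in> O_maps n"
  by (auto simp: O_maps_def mappings_def order_preserving_iff_nondecreasing)

lemma O_maps_subset_OP_maps: "0 < n \<Longrightarrow> O_maps n \<subseteq> OP_maps n"
  by (auto simp: O_maps_def OP_maps_eq order_preserving_iff_cut_at_0)

lemma order_preserving_gen_in_Delta_gens:
  assumes "\<alpha> \<in> O_maps n" "n - 1 \<le> map_rank n \<alpha>"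
  shows "\<alpha> \<in> Delta_gens n t"
proof -
  have "inversions D \<alpha> = {}" if "D \<subseteq> {..<n}" for D
    using assms(1) that
    by (fastforce simp: O_maps_def order_preserving_iff_nondecreasing inversions_def)
  then show ?thesis using assms by (simp add: Delta_gens_def even_on_def O_maps_def)
qed

definition collapse :: "nat \<Rightarrow> nat \<Rightarrow> nat \<Rightarrow> nat \<Rightarrow> nat" where
  "collapse n y z = (\<lambda>x\<in>{..<n}. if x = y then z else x)"

lemma collapse_in_Delta_gens:
  assumes "y < n" "z < n" "z = Suc y \<or> y = Suc z"
  shows "collapse n y z \<in> Delta_gens n t"
proof (rule order_preserving_gen_in_Delta_gens)
  show "collapse n y z \<in> O_maps n"
    using assms by (auto simp: O_maps_def mappings_def order_preserving_iff_nondecreasing collapse_def)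
  have "{..<n} - {y} \<subseteq> collapse n y z ` {..<n}"
    by (auto simp: collapse_def image_iff)
  then have "card ({..<n} - {y}) \<le> map_rank n (collapse n y z)"
    unfolding map_rank_def by (intro card_mono) auto
  then show "n - 1 \<le> map_rank n (collapse n y z)" using assms(1) by simp
qed

text \<open>
  If \<open>y\<close> and its neighbour \<open>z\<close> have the same value, then \<open>collapse n y z\<close> can be split off on
  the right, and the remaining factor may take any value at \<open>y\<close> that keeps it order-preserving.
  A value one step closer to \<open>y\<close> reduces the distance from the identity. Such a pair exists
  because the successor of the last point that \<open>\<alpha>\<close> moves up, like the predecessor of the first
  one that it moves down, is forced to be fixed and to share the value of that point.
\<close>

lemma O_map_collapse_factor:
  assumes \<alpha>: "\<alpha> \<in> O_maps n" and "\<alpha> \<noteq> (\<lambda>x\<in>{..<n}. x)"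
  obtains \<beta> y z where "\<beta> \<in> O_maps n" "y < n" "z < n" "z = Suc y \<or> y = Suc z"
    "\<alpha> = compose {..<n} \<beta> (collapse n y z)"
    "(\<Sum>x<n. nat \<bar>int (\<beta> x) - int x\<bar>) < (\<Sum>x<n. nat \<bar>int (\<alpha> x) - int x\<bar>)"
proof -
  have map: "\<alpha> \<in> mappings n" and mono: "\<And>x y. \<lbrakk>x \<le> y; y < n\<rbrakk> \<Longrightarrow> \<alpha> x \<le> \<alpha> y"
    using \<alpha> by (auto simp: O_maps_def order_preserving_iff_nondecreasing le_less)
  note less = mappings_less[OF map]
  note result = that
  have factor: thesis if yz: "y < n" "z < n" "z = Suc y \<or> y = Suc z" and eq: "\<alpha> y = \<alpha> z"
    and v: "v < n" "\<And>x. x < y \<Longrightarrow> \<alpha> x \<le> v" "\<And>x. \<lbrakk>y < x; x < n\<rbrakk> \<Longrightarrow> v \<le> \<alpha> x"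
      "\<bar>int v - int y\<bar> < \<bar>int (\<alpha> y) - int y\<bar>" for y z v
  proof (rule result)
    let ?\<beta> = "\<alpha>(y := v)"
    have \<beta>: "?\<beta> \<in> mappings n" using map yz(1) v(1) by (simp add: mappings_def PiE_iff extensional_def)
    show "?\<beta> \<in> O_maps n"
      using \<beta> v(2,3) mono by (simp add: O_maps_def order_preserving_iff_nondecreasing)
    show "\<alpha> = compose {..<n} ?\<beta> (collapse n y z)"
    proof (rule mappings_eqI[OF map compose_in_mappings[OF \<beta>]])
      show "collapse n y z \<in> mappings n" using yz by (auto simp: collapse_def mappings_def)
      have "z \<noteq> y" using yz(3) by auto
      then show "\<alpha> x = compose {..<n} ?\<beta> (collapse n y z) x" if "x < n" for x
        using that by (cases "x = y") (simp_all add: eq compose_below collapse_def)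
    qed
    show "(\<Sum>x<n. nat \<bar>int (?\<beta> x) - int x\<bar>) < (\<Sum>x<n. nat \<bar>int (\<alpha> x) - int x\<bar>)"
    proof (rule sum_strict_mono_ex1)
      show "\<exists>x\<in>{..<n}. nat \<bar>int (?\<beta> x) - int x\<bar> < nat \<bar>int (\<alpha> x) - int x\<bar>"
        using yz(1) v(4) by (intro bexI[of _ y]) auto
    qed (use v(4) in auto)
  qed (use yz in auto)
  obtain x where x: "x < n" "\<alpha> x \<noteq> x"
    using assms(2) mappings_eqI[OF map, of "\<lambda>x\<in>{..<n}. x"] by (auto simp: mappings_def)
  then consider "\<exists>x<n. x < \<alpha> x" | "\<exists>x<n. \<alpha> x < x" by (metis nat_neq_iff)
  then show thesis
  proof cases
    case 1
    define m where "m = Max {x. x < n \<and> x < \<alpha> x}"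
    have m: "m < n" "m < \<alpha> m" using 1 Max_in[of "{x. x < n \<and> x < \<alpha> x}"] by (auto simp: m_def)
    have after: "\<alpha> x \<le> x" if "m < x" "x < n" for x
    proof (rule ccontr)
      assume "\<not> \<alpha> x \<le> x"
      then have "x \<le> m" unfolding m_def using that by (intro Max_ge) auto
      then show False using that by simp
    qed
    have Sm: "Suc m < n" using m less[OF m(1)] by simp
    have am: "\<alpha> (Suc m) = Suc m" "\<alpha> m = Suc m"
      using after[of "Suc m"] mono[of m "Suc m"] m Sm by auto
    \<comment> \<open>\<open>m\<close> and \<open>Suc m\<close> share the value \<open>Suc m\<close>. Only the first point of that block may go down to \<open>m\<close>.\<close>
    define y where "y = (LEAST y. \<alpha> y = Suc m)"
    have y: "\<alpha> y = Suc m" "y \<le> m"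
      unfolding y_def by (rule LeastI[of _ m], rule am, rule Least_le, rule am)
    have before: "\<alpha> x \<le> m" if "x < y" for x
      using not_less_Least[of x "\<lambda>y. \<alpha> y = Suc m"] that mono[of x y] y m(1)
      unfolding y_def[symmetric] by simp
    show thesis
    proof (rule factor[of y "Suc y" m])
      show "\<alpha> y = \<alpha> (Suc y)" using mono[of y "Suc y"] mono[of "Suc y" "Suc m"] y am Sm by simp
      show "m \<le> \<alpha> x" if "y < x" "x < n" for x using mono[of y x] that y by simp
    qed (use y before m Sm in auto)
  next
    case 2
    define m where "m = (LEAST x. x < n \<and> \<alpha> x < x)"
    have m: "m < n" "\<alpha> m < m" using 2 LeastI_ex[of "\<lambda>x. x < n \<and> \<alpha> x < x"] by (auto simp: m_def)
    have bef: "x \<le> \<alpha> x" if "x < m" for x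
      using not_less_Least[of x "\<lambda>x. x < n \<and> \<alpha> x < x"] that m(1) by (auto simp: m_def)
    obtain p where p: "m = Suc p" using m by (cases m) auto
    have am: "\<alpha> p = p" "\<alpha> m = p"
      using bef[of p] mono[of p m] m p by auto
    \<comment> \<open>Symmetrically, only the last point of the block of \<open>p\<close> may go up to \<open>m\<close>.\<close>
    define y where "y = Max {y. y < n \<and> \<alpha> y = p}"
    have "y \<in> {y. y < n \<and> \<alpha> y = p}" unfolding y_def by (rule Max_in) (use am m in auto)
    then have y: "y < n" "\<alpha> y = p" by auto
    have my: "m \<le> y" unfolding y_def by (rule Max_ge) (use am m in auto)
    have aft: "m \<le> \<alpha> x" if "y < x" "x < n" for x
    proof -
      have "\<alpha> x \<noteq> p"
      proof
        assume "\<alpha> x = p"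
        then have "x \<le> y" unfolding y_def using that by (intro Max_ge) auto
        then show False using that by simp
      qed
      then show ?thesis using mono[of y x] that y p by simp
    qed
    show thesis
    proof (rule factor[of y "y - 1" m])
      show "\<alpha> y = \<alpha> (y - 1)" using mono[of "y - 1" y] mono[of p "y - 1"] y my am p by simp
      show "\<alpha> x \<le> m" if "x < y" for x using mono[of x y] that y p by simp
    qed (use y my aft m p in auto)
  qed
qed

lemma O_maps_subset_Delta: "O_maps n \<subseteq> Delta n t"
proof
  fix \<alpha> assume "\<alpha> \<in> O_maps n"
  then show "\<alpha> \<in> Delta n t"
  proof (induction "\<Sum>x<n. nat \<bar>int (\<alpha> x) - int x\<bar>" arbitrary: \<alpha> rule: less_induct)
    case less
    show ?case
    proof (cases "\<alpha> = (\<lambda>x\<in>{..<n}. x)")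
      case True
      then show ?thesis by (simp add: Delta_def generated_monoid.one)
    next
      case False
      obtain \<beta> y z where f: "\<beta> \<in> O_maps n" "y < n" "z < n" "z = Suc y \<or> y = Suc z"
        "\<alpha> = compose {..<n} \<beta> (collapse n y z)"
        "(\<Sum>x<n. nat \<bar>int (\<beta> x) - int x\<bar>) < (\<Sum>x<n. nat \<bar>int (\<alpha> x) - int x\<bar>)"
        by (rule O_map_collapse_factor[OF less.prems False])
      have "\<beta> \<in> Delta n t" using less.hyps f by blast
      then show ?thesis
        using collapse_in_Delta_gens[OF f(2-4)] f(5)
        by (simp add: Delta_def generated_monoid.comp generated_monoid.incl)
    qed
  qed
qed

lemma map_rank_inj: "inj_on \<alpha> {..<n} \<Longrightarrow> map_rank n \<alpha> = n"
  by (simp add: map_rank_def card_image)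

lemma inj_on_rotation: "inj_on (rotation n) {..<n}"
  by (auto simp: inj_on_def rotation_def split: if_splits)

lemma inj_on_reversal: "inj_on (reversal n) {..<n}"
  by (auto simp: inj_on_def reversal_def)

lemma OP_maps_subset_Delta:
  assumes "0 < n" "rotation n \<in> Delta_gens n t"
  shows "OP_maps n \<subseteq> Delta n t"
proof
  fix \<alpha> assume "\<alpha> \<in> OP_maps n"
  then obtain k where "\<alpha> \<in> mappings n" "cut_at n k \<alpha>" "k \<le> n" using assms by (auto simp: OP_maps_eq)
  then show "\<alpha> \<in> Delta n t"
  proof (induction rule: cut_map_induct)
    case (order_preserving \<beta>)
    then show ?case using O_maps_subset_Delta by blast
  next
    case (rotation \<beta>)
    then show ?case
      using assms(2) by (simp add: Delta_def generated_monoid.comp generated_monoid.incl)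
  qed
qed

lemma reversal_image_subset_Delta:
  assumes "reversal n \<in> Delta_gens n t" "A \<subseteq> Delta n t"
  shows "compose {..<n} (reversal n) ` A \<subseteq> Delta n t"
  using assms by (auto simp: Delta_def intro!: generated_monoid.comp[OF generated_monoid.incl])

section \<open>Generators are monotone or oriented\<close>

lemma even_triple_is_cyclic:
  assumes "\<not> odd_triple \<alpha> x y z" "x < y" "y < z" "\<alpha> x \<noteq> \<alpha> y" "\<alpha> y \<noteq> \<alpha> z" "\<alpha> x \<noteq> \<alpha> z"
  shows "\<alpha> x < \<alpha> y \<and> \<alpha> y < \<alpha> z \<or> \<alpha> y < \<alpha> z \<and> \<alpha> z < \<alpha> x \<or> \<alpha> z < \<alpha> x \<and> \<alpha> x < \<alpha> y"
  using assms by (auto simp: odd_triple_def discordant_def)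

text \<open>
  Two cyclic descents involve three or four positions. Three positions would form an injective
  triple with two descents, which is odd. For four positions with values
  \<open>p > q\<close> and \<open>r > s\<close>, cyclic order of the triples \<open>(p, q, s)\<close> and \<open>(q, r, s)\<close> would
  require both \<open>q < s\<close> and \<open>s < q\<close>. If one of these triples is not injective, the
  other triples lead to a contradiction, since a second collision is impossible.
\<close>

lemma cyclic_seq_if_even_triples:
  assumes n: "3 \<le> n" and rank: "n - 1 \<le> map_rank n \<alpha>"
    and even: "\<And>x y z. \<lbrakk>x < n; y < n; z < n; \<alpha> x \<noteq> \<alpha> y; \<alpha> y \<noteq> \<alpha> z; \<alpha> x \<noteq> \<alpha> z\<rbrakk>
      \<Longrightarrow> \<not> odd_triple \<alpha> x y z"
  shows "cyclic_seq (map \<alpha> [0..<n])"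
proof -
  define Ds where "Ds = {i. i < n \<and> \<alpha> i > \<alpha> (Suc i mod n)}"
  define cyclic where "cyclic p q r \<longleftrightarrow> p < q \<and> q < r \<or> q < r \<and> r < p \<or> r < p \<and> p < q
      \<or> p = q \<or> q = r \<or> p = r" for p q r :: nat
  have cyc: "cyclic (\<alpha> x) (\<alpha> y) (\<alpha> z)" if "x < y" "y < z" "z < n" for x y z
  proof (cases "\<alpha> x = \<alpha> y \<or> \<alpha> y = \<alpha> z \<or> \<alpha> x = \<alpha> z")
    case False
    then have "\<not> odd_triple \<alpha> x y z" using that by (intro even) auto
    then show ?thesis using even_triple_is_cyclic[of \<alpha> x y z] that False by (simp add: cyclic_def)
  qed (auto simp: cyclic_def)
  have coll: "x = x' \<and> y = y'"
    if "\<alpha> x = \<alpha> y" "\<alpha> x' = \<alpha> y'" "x < y" "x' < y'" "y < n" "y' < n" for x y x' y'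
    using unique_collision[OF rank that(3,5,1,4,6,2)] .
  have no3: "\<not> (\<alpha> x > \<alpha> y \<and> \<alpha> y > \<alpha> z) \<and> \<not> (\<alpha> y > \<alpha> z \<and> \<alpha> z > \<alpha> x) \<and> \<not> (\<alpha> z > \<alpha> x \<and> \<alpha> x > \<alpha> y)"
    if "x < y" "y < z" "z < n" for x y z
    using cyc[OF that] by (auto simp: cyclic_def)
  have no4: "\<not> (\<alpha> a > \<alpha> b \<and> \<alpha> c > \<alpha> d) \<and> \<not> (\<alpha> b > \<alpha> c \<and> \<alpha> d > \<alpha> a)"
    if abcd: "a < b" "b < c" "c < d" "d < n" for a b c d
  proof -
    have coll4: "\<not> (\<alpha> b = \<alpha> d \<and> \<alpha> a = \<alpha> c)" "\<not> (\<alpha> b = \<alpha> c \<and> \<alpha> a = \<alpha> d)"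
      "\<not> (\<alpha> a = \<alpha> b \<and> \<alpha> c = \<alpha> d)"
      using coll[of b d a c] coll[of b c a d] coll[of a b c d] abcd by auto
    have contra: False
      if "q < p" "s < r" "\<not> (q = s \<and> p = r)" "\<not> (q = r \<and> p = s)"
        and "cyclic p q s" "cyclic q r s" "cyclic p q r" "cyclic p r s" for p q r s
    proof -
      have "q < s \<and> s < p \<or> q = s \<or> p = s" using that(1,5) by (auto simp: cyclic_def)
      then show False
      proof (elim disjE)
        assume "q < s \<and> s < p"
        then show False using that(2,6) by (auto simp: cyclic_def)
      next
        assume "q = s"
        then show False using that(1-3,7,8) by (auto simp: cyclic_def)
      next
        assume "p = s"
        then show False using that(1,2,4,6) by (auto simp: cyclic_def)
      qed
    qed
    have rot: "cyclic p q r \<Longrightarrow> cyclic q r p" for p q r by (auto simp: cyclic_def)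
    note triples = cyc[of a b c] cyc[of a b d] cyc[of a c d] cyc[of b c d]
    have "\<not> (\<alpha> a > \<alpha> b \<and> \<alpha> c > \<alpha> d)"
      using contra[of "\<alpha> b" "\<alpha> a" "\<alpha> d" "\<alpha> c"] triples coll4 abcd by auto
    \<comment> \<open>For descents at \<open>b\<close> and \<open>d\<close> the cyclic sequence is read from \<open>b\<close> on.\<close>
    moreover have "\<not> (\<alpha> b > \<alpha> c \<and> \<alpha> d > \<alpha> a)"
      using contra[of "\<alpha> c" "\<alpha> b" "\<alpha> a" "\<alpha> d"] triples(4) triples(1-3)[THEN rot] coll4 abcd by auto
    ultimately show ?thesis by blast
  qed
  have "\<not> (i \<in> Ds \<and> j \<in> Ds)" if "i < j" for i j
  proof
    assume "i \<in> Ds \<and> j \<in> Ds"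
    then have ij: "j < n" "\<alpha> i > \<alpha> (Suc i)" "\<alpha> j > \<alpha> (Suc j mod n)"
      using that by (auto simp: Ds_def)
    show False
    proof (cases "Suc j < n")
      case True
      then show False
        using no3[of i j "Suc j"] no4[of i "Suc i" j "Suc j"] ij that by (cases "j = Suc i") auto
    next
      case False
      then have "Suc j = n" using ij by simp
      then have "\<alpha> j > \<alpha> 0" using ij by auto
      then show False
        using no3[of 0 "Suc 0" j] no3[of 0 i j] no4[of 0 i "Suc i" j] ij that n \<open>Suc j = n\<close>
        by (cases "i = 0"; cases "j = Suc i") auto
    qed
  qed
  then have "\<forall>i\<in>Ds. \<forall>j\<in>Ds. i = j" by (meson nat_neq_iff)
  moreover have "finite Ds" by (simp add: Ds_def)
  ultimately have "card Ds \<le> 1" by (simp add: card_le_Suc0_iff_eq)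
  moreover have "{i. i < n \<and> map \<alpha> [0..<n] ! i > map \<alpha> [0..<n] ! (Suc i mod n)} = Ds"
    using n by (auto simp: Ds_def)
  ultimately show ?thesis by (simp add: cyclic_seq_def)
qed

text \<open>
  Reversing the values changes the parity of all three pairs, hence that of the triple. This
  reduces the anti-cyclic case to the cyclic one.
\<close>

lemma odd_triple_reversal:
  assumes "\<alpha> \<in> mappings n" "x < n" "y < n" "z < n" "\<alpha> x \<noteq> \<alpha> y" "\<alpha> y \<noteq> \<alpha> z" "\<alpha> x \<noteq> \<alpha> z"
  shows "odd_triple (compose {..<n} (reversal n) \<alpha>) x y z \<longleftrightarrow> \<not> odd_triple \<alpha> x y z"
proof -
  have flip: "discordant (compose {..<n} (reversal n) \<alpha>) u v \<longleftrightarrow> \<not> discordant \<alpha> u v"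
    if "u < n" "v < n" "\<alpha> u \<noteq> \<alpha> v" for u v
  proof -
    have "u \<noteq> v" using that by auto
    then show ?thesis
      using mappings_less[OF assms(1) that(1)] mappings_less[OF assms(1) that(2)] that
      by (auto simp: discordant_def compose_below reversal_def)
  qed
  show ?thesis using assms by (auto simp: odd_triple_def flip)
qed

lemma map_rank_compose_reversal:
  assumes "\<alpha> \<in> mappings n"
  shows "map_rank n (compose {..<n} (reversal n) \<alpha>) = map_rank n \<alpha>"
proof -
  have "compose {..<n} (reversal n) \<alpha> ` {..<n} = reversal n ` (\<alpha> ` {..<n})"
    by (auto simp: compose_below image_iff)
  moreover have "inj_on (reversal n) (\<alpha> ` {..<n})"
    by (rule inj_on_subset[OF inj_on_reversal]) (use mappings_less[OF assms] in auto)
  ultimately show ?thesis by (simp add: map_rank_def card_image)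
qed

lemma anti_cyclic_if_odd_triples:
  assumes n: "3 \<le> n" and \<alpha>: "\<alpha> \<in> mappings n" and rank: "n - 1 \<le> map_rank n \<alpha>"
    and odd: "\<And>x y z. \<lbrakk>x < n; y < n; z < n; \<alpha> x \<noteq> \<alpha> y; \<alpha> y \<noteq> \<alpha> z; \<alpha> x \<noteq> \<alpha> z\<rbrakk>
      \<Longrightarrow> odd_triple \<alpha> x y z"
  shows "anti_cyclic_seq (map \<alpha> [0..<n])"
  unfolding anti_cyclic_seq_iff_reversal[OF \<alpha>]
proof (rule cyclic_seq_if_even_triples[OF n])
  show "n - 1 \<le> map_rank n (compose {..<n} (reversal n) \<alpha>)"
    using rank by (simp add: map_rank_compose_reversal[OF \<alpha>])
  show "\<not> odd_triple (compose {..<n} (reversal n) \<alpha>) x y z"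
    if "x < n" "y < n" "z < n"
      "compose {..<n} (reversal n) \<alpha> x \<noteq> compose {..<n} (reversal n) \<alpha> y"
      "compose {..<n} (reversal n) \<alpha> y \<noteq> compose {..<n} (reversal n) \<alpha> z"
      "compose {..<n} (reversal n) \<alpha> x \<noteq> compose {..<n} (reversal n) \<alpha> z" for x y z
  proof -
    have "\<alpha> x \<noteq> \<alpha> y" "\<alpha> y \<noteq> \<alpha> z" "\<alpha> x \<noteq> \<alpha> z" using that by (auto simp: compose_below)
    then show ?thesis using odd_triple_reversal[OF \<alpha>] odd that(1-3) by simp
  qed
qed

lemma Delta_gens_injective_domain:
  assumes gen: "\<alpha> \<in> Delta_gens n t" and "t + 1 \<le> n"
  obtains D where "D \<subseteq> {..<n}" "card D = t" "inj_on \<alpha> D" "even (card (inversions D \<alpha>))"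
proof -
  have rank: "n - 1 \<le> map_rank n \<alpha>" using gen by (simp add: Delta_gens_def)
  have "card {} + t \<le> n - 1" using assms(2) by simp
  then obtain D where "D \<subseteq> {..<n}" "card D = t" "inj_on \<alpha> D"
    using exists_disjoint_injective_extension[OF rank empty_subsetI inj_on_empty, of t]
    by (metis Un_empty_right)
  then show thesis using gen that by (auto simp: Delta_gens_def even_on_def)
qed

text \<open>
  For an injective set \<open>E \<union> {a, b}\<close> with \<open>E\<close> of size \<open>t - 1\<close>, which is odd, a pair \<open>{a, b}\<close>
  disagreeing with the common parity of the triples would make the degrees of \<open>a\<close> and \<open>b\<close>
  in \<open>E\<close> differ in parity.
\<close>

lemma Delta_gens_even_width_agreement:
  assumes gen: "\<alpha> \<in> Delta_gens n t" and t: "2 \<le> t" "t + 3 \<le> n" "even t"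
    and c: "\<And>x y z. \<lbrakk>x < n; y < n; z < n; \<alpha> x \<noteq> \<alpha> y; \<alpha> y \<noteq> \<alpha> z; \<alpha> x \<noteq> \<alpha> z\<rbrakk>
      \<Longrightarrow> odd_triple \<alpha> x y z = c"
    and ab: "a < n" "b < n" "\<alpha> a \<noteq> \<alpha> b"
  shows "discordant \<alpha> a b = c"
proof (rule ccontr)
  assume neq: "discordant \<alpha> a b \<noteq> c"
  have rank: "n - 1 \<le> map_rank n \<alpha>" using gen by (simp add: Delta_gens_def)
  have le: "card {a, b} + (t - 1) \<le> n - 1" using ab(3) t by (auto simp: card_insert_if)
  obtain E where E: "E \<subseteq> {..<n}" "E \<inter> {a, b} = {}" "card E = t - 1"
      "inj_on \<alpha> (E \<union> {a, b})"
    by (rule exists_disjoint_injective_extension[OF rank _ _ le]) (use ab in auto)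
  have fin: "finite E" using E(1) finite_subset by blast
  have "even (card {e \<in> E. discordant \<alpha> a e} + card {e \<in> E. discordant \<alpha> b e})"
  proof (rule Delta_gens_degree_parity[OF gen])
    show "inj_on \<alpha> (insert a (insert b E))" using E(4) by simp
    show "a \<notin> E" "b \<notin> E" using E(2) by auto
  qed (use E ab t in simp_all)
  moreover have "odd_triple \<alpha> a b e = c" if "e \<in> E" for e
  proof (rule c)
    have "e \<noteq> a" "e \<noteq> b" using that E(2) by auto
    then show "\<alpha> b \<noteq> \<alpha> e" "\<alpha> a \<noteq> \<alpha> e"
      using that inj_on_eq_iff[OF E(4), of b e] inj_on_eq_iff[OF E(4), of a e] by simp_all
  qed (use that ab E(1) in auto)
  then have "odd (card {e \<in> E. discordant \<alpha> a e} + card {e \<in> E. discordant \<alpha> b e})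
      \<longleftrightarrow> odd (card E) \<and> c \<noteq> discordant \<alpha> a b"
    by (rule discordance_degrees_parity[OF fin])
  ultimately show False using neq E(3) t by auto
qed

lemma Delta_gens_even_width:
  assumes gen: "\<alpha> \<in> Delta_gens n t" and t: "2 \<le> t" "t + 3 \<le> n" "even t"
  shows "\<alpha> \<in> O_maps n \<or> t mod 4 = 0 \<and> \<alpha> \<in> M_maps n"
proof -
  have \<alpha>: "\<alpha> \<in> mappings n" using gen by (simp add: Delta_gens_def)
  obtain c where "\<forall>x<n. \<forall>y<n. \<forall>z<n.
      \<alpha> x \<noteq> \<alpha> y \<and> \<alpha> y \<noteq> \<alpha> z \<and> \<alpha> x \<noteq> \<alpha> z \<longrightarrow> odd_triple \<alpha> x y z = c"
    by (rule Delta_gens_triples_constant[OF gen t(1,2)])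
  then have c: "odd_triple \<alpha> x y z = c"
    if "x < n" "y < n" "z < n" "\<alpha> x \<noteq> \<alpha> y" "\<alpha> y \<noteq> \<alpha> z" "\<alpha> x \<noteq> \<alpha> z" for x y z
    using that by simp
  have agree: "discordant \<alpha> x y = c" if "x < n" "y < n" "\<alpha> x \<noteq> \<alpha> y" for x y
    by (rule Delta_gens_even_width_agreement[OF gen t c that])
  show ?thesis
  proof (cases c)
    case False
    then have "\<alpha> x \<le> \<alpha> y" if "x < y" "y < n" for x y
      using agree[of x y] that by (fastforce simp: discordant_def)
    then show ?thesis using \<alpha> by (simp add: O_maps_def order_preserving_iff_nondecreasing)
  next
    case True
    then have desc: "\<alpha> y < \<alpha> x" if "x < y" "y < n" "\<alpha> x \<noteq> \<alpha> y" for x y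
      using agree[of x y] that by (fastforce simp: discordant_def)
    then have "order_reversing n \<alpha>"
      unfolding order_reversing_def monotone_on_def by (metis lessThan_iff le_refl less_imp_le)
    then have "\<alpha> \<in> M_maps n" using \<alpha> by (simp add: M_maps_def)
    moreover obtain D where D: "D \<subseteq> {..<n}" "card D = t" "inj_on \<alpha> D" "even (card (inversions D \<alpha>))"
      using Delta_gens_injective_domain[OF gen] t(2) by auto
    have "card (inversions D \<alpha>) = t choose 2"
      unfolding D(2)[symmetric]
    proof (rule card_inversions_decreasing)
      show "finite D" using D(1) finite_subset by blast
      show "\<alpha> y < \<alpha> x" if "x \<in> D" "y \<in> D" "x < y" for x y
        using desc[of x y] that D(1,3) by (auto simp: inj_on_def)
    qed
    then have "t mod 4 = 0" using D(4) t(3) by (simp add: even_choose_2_iff) presburger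
    ultimately show ?thesis by simp
  qed
qed

lemma Delta_gens_odd_width:
  assumes gen: "\<alpha> \<in> Delta_gens n t" and t: "2 \<le> t" "t + 3 \<le> n" "odd t"
  shows "\<alpha> \<in> OP_maps n \<or> t mod 4 = 1 \<and> \<alpha> \<in> OR_maps n"
proof -
  have \<alpha>: "\<alpha> \<in> mappings n" and rank: "n - 1 \<le> map_rank n \<alpha>" using gen by (simp_all add: Delta_gens_def)
  have n3: "3 \<le> n" using t by simp
  obtain c where "\<forall>x<n. \<forall>y<n. \<forall>z<n.
      \<alpha> x \<noteq> \<alpha> y \<and> \<alpha> y \<noteq> \<alpha> z \<and> \<alpha> x \<noteq> \<alpha> z \<longrightarrow> odd_triple \<alpha> x y z = c"
    by (rule Delta_gens_triples_constant[OF gen t(1,2)])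
  then have c: "odd_triple \<alpha> x y z = c"
    if "x < n" "y < n" "z < n" "\<alpha> x \<noteq> \<alpha> y" "\<alpha> y \<noteq> \<alpha> z" "\<alpha> x \<noteq> \<alpha> z" for x y z
    using that by simp
  show ?thesis
  proof (cases c)
    case False
    then have "cyclic_seq (map \<alpha> [0..<n])"
      using c by (intro cyclic_seq_if_even_triples[OF n3 rank]) simp
    then show ?thesis using \<alpha> by (simp add: OP_maps_def)
  next
    case True
    then have "anti_cyclic_seq (map \<alpha> [0..<n])"
      using c by (intro anti_cyclic_if_odd_triples[OF n3 \<alpha> rank]) simp
    then have "\<alpha> \<in> OR_maps n" using \<alpha> by (simp add: OR_maps_def oriented_seq_def)
    moreover obtain D where D: "D \<subseteq> {..<n}" "card D = t" "inj_on \<alpha> D" "even (card (inversions D \<alpha>))"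
      using Delta_gens_injective_domain[OF gen] t(2) by auto
    obtain k where k: "t = 2 * k + 1" using t(3) by (elim oddE)
    have "odd (card (inversions D \<alpha>)) \<longleftrightarrow> c \<and> odd k"
    proof (rule inversions_parity_odd_width)
      show "card D = 2 * k + 1" using D(2) k by simp
      show "odd_triple \<alpha> x y z = c"
        if "x \<in> D" "y \<in> D" "z \<in> D" "x \<noteq> y" "y \<noteq> z" "x \<noteq> z" for x y z
        using that D(1,3) by (intro c) (auto simp: inj_on_def)
    qed
    then have "even k" using D(4) True by simp
    then have "t mod 4 = 1" unfolding k by (auto elim!: evenE)
    ultimately show ?thesis by simp
  qed
qed

section \<open>The even permutations, and the four cases\<close>

text \<open>
  The rotation makes discordant exactly the pairs that contain \<open>0\<close>, and of the
  three pairs in a triple either none or two contain \<open>0\<close>.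
\<close>

lemma rotation_in_Delta_gens:
  assumes "odd t"
  shows "rotation n \<in> Delta_gens n t"
proof -
  obtain k where k: "t = 2 * k + 1" using assms by (elim oddE)
  have "\<not> odd (card (inversions D (rotation n)))" if D: "D \<subseteq> {..<n}" "card D = t" for D
  proof -
    have "odd (card (inversions D (rotation n))) \<longleftrightarrow> False \<and> odd k"
    proof (rule inversions_parity_odd_width)
      show "card D = 2 * k + 1" using D k by simp
      have zero: "discordant (rotation n) x y \<longleftrightarrow> x \<noteq> y \<and> (x = 0 \<or> y = 0)" if "x \<in> D" "y \<in> D" for x y
      proof -
        have "x < n" "y < n" using that D(1) by auto
        then show ?thesis by (auto simp: discordant_def rotation_def)
      qed
      show "odd_triple (rotation n) x y z = False"
        if "x \<in> D" "y \<in> D" "z \<in> D" "x \<noteq> y" "y \<noteq> z" "x \<noteq> z" for x y z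
        using that by (auto simp: odd_triple_def zero)
    qed
    then show ?thesis by simp
  qed
  then show ?thesis
    by (simp add: Delta_gens_def even_on_def rotation_in_mappings map_rank_inj inj_on_rotation)
qed

lemma reversal_in_Delta_gens:
  assumes "t mod 4 = 0 \<or> t mod 4 = 1"
  shows "reversal n \<in> Delta_gens n t"
proof -
  have "even (card (inversions D (reversal n)))" if D: "D \<subseteq> {..<n}" "card D = t" for D
  proof -
    have "card (inversions D (reversal n)) = card D choose 2"
    proof (rule card_inversions_decreasing)
      show "finite D" using finite_subset[OF D(1)] by simp
    qed (use D(1) in \<open>auto simp: reversal_def\<close>)
    then show ?thesis using D(2) assms even_choose_2_iff by simp
  qed
  then show ?thesis
    by (simp add: Delta_gens_def even_on_def reversal_in_mappings map_rank_inj inj_on_reversal)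
qed

theorem theorem23:
  fixes n t :: nat
  assumes "0 < n" and "2 \<le> t" and "t + 3 \<le> n"
  shows "(t mod 4 = 2 \<longrightarrow> Delta n t = O_maps n) \<and>
         (t mod 4 = 3 \<longrightarrow> Delta n t = OP_maps n) \<and>
         (t mod 4 = 0 \<longrightarrow> Delta n t = M_maps n) \<and>
         (t mod 4 = 1 \<longrightarrow> Delta n t = OR_maps n)"
proof (intro conjI impI)
  have O_sub: "O_maps n \<subseteq> mappings n" by (auto simp: O_maps_def)
  have OP_sub: "OP_maps n \<subseteq> mappings n" by (auto simp: OP_maps_def)
  note id = identity_in_O_maps[of n]
  note id_OP = subsetD[OF O_maps_subset_OP_maps[OF assms(1)] id]
  {
    assume mod: "t mod 4 = 2"
    then have "even t" by presburger
    then have "Delta_gens n t \<subseteq> O_maps n"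
      using Delta_gens_even_width assms(2,3) mod by fastforce
    then have "Delta n t \<subseteq> O_maps n"
      unfolding Delta_def by (intro generated_monoid_subset id O_maps_compose)
    then show "Delta n t = O_maps n" using O_maps_subset_Delta by blast
  next
    assume mod: "t mod 4 = 3"
    then have "odd t" by presburger
    then have "Delta_gens n t \<subseteq> OP_maps n"
      using Delta_gens_odd_width assms(2,3) mod by fastforce
    then have "Delta n t \<subseteq> OP_maps n"
      unfolding Delta_def by (intro generated_monoid_subset id_OP OP_maps_compose assms(1))
    then show "Delta n t = OP_maps n"
      using OP_maps_subset_Delta[OF assms(1) rotation_in_Delta_gens] \<open>odd t\<close> by blast
  next
    assume mod: "t mod 4 = 0"
    then have "even t" by presburger
    have "Delta_gens n t \<subseteq> M_maps n"
      using Delta_gens_even_width[OF _ assms(2,3) \<open>even t\<close>] by (auto simp: M_maps_def O_maps_def)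
    then have "Delta n t \<subseteq> M_maps n"
      unfolding Delta_def M_maps_eq
    proof (rule generated_monoid_subset)
      show "(\<lambda>x\<in>{..<n}. x) \<in> O_maps n \<union> compose {..<n} (reversal n) ` O_maps n"
        using id by blast
    qed (rule adjoin_reversal_closed[OF O_sub O_maps_compose O_maps_conj_reversal])
    moreover have "M_maps n \<subseteq> Delta n t"
      unfolding M_maps_eq
      by (intro Un_least O_maps_subset_Delta reversal_image_subset_Delta reversal_in_Delta_gens)
        (simp add: mod)
    ultimately show "Delta n t = M_maps n" by (rule equalityI)
  next
    assume mod: "t mod 4 = 1"
    then have "odd t" by presburger
    have "Delta_gens n t \<subseteq> OR_maps n"
      using Delta_gens_odd_width[OF _ assms(2,3) \<open>odd t\<close>] by (auto simp: OR_maps_eq)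
    then have "Delta n t \<subseteq> OR_maps n"
      unfolding Delta_def OR_maps_eq
    proof (rule generated_monoid_subset)
      show "(\<lambda>x\<in>{..<n}. x) \<in> OP_maps n \<union> compose {..<n} (reversal n) ` OP_maps n"
        using id_OP by blast
    qed (rule adjoin_reversal_closed[OF OP_sub OP_maps_compose[OF assms(1)] OP_maps_conj_reversal[OF assms(1)]])
    moreover have "OR_maps n \<subseteq> Delta n t"
      unfolding OR_maps_eq
      by (intro Un_least OP_maps_subset_Delta rotation_in_Delta_gens reversal_image_subset_Delta
          reversal_in_Delta_gens assms(1) \<open>odd t\<close>) (simp add: mod)
    ultimately show "Delta n t = OR_maps n" by (rule equalityI)
  }
qed

end
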